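(* Let $r\geq 1$ and $n\geq r^2+r+1$ be integers, and let $G$ be a bipartite graph on $n$ vertices without isolated vertices such that $b(G)<\frac{1}{r}$. Let $$f(n,r)=\Big\lfloor\frac{n-1}{r+1}\Big\rfloor\Big(n-\Big\lfloor\frac{n-1}{r+1}\Big\rfloor\Big),\qquad g(n,r)=\Big\lfloor\frac{n-r-1}{2}\Big\rfloor\Big\lceil\frac{n-r-1}{2}\Big\rceil+r+1.$$ Then: (i) If $r=1$, then $e(G)\leq f(n,1)$, with equality if and only if $G\cong K_{n-\lfloor\frac{n-1}{2}\rfloor,\lfloor\frac{n-1}{2}\rfloor}$. (ii) If $r\geq 2$ and $f(n,r)>g(n,r)$, then $e(G)\leq f(n,r)$, with equality if and only if $G\cong K_{n-\lfloor\frac{n-1}{r+1}\rfloor,\lfloor\frac{n-1}{r+1}\rfloor}$. (iii) If $r\geq 2$ and $f(n,r)<g(n,r)$, then $e(G)\leq g(n,r)$, with equality if and only if $G\in\Big\{D\big(\lceil\frac{n-r-1}{2}\rceil,r+1;1,\lfloor\frac{n-r-1}{2}\rfloor-1\big),\ D\big(\lfloor\frac{n-r-1}{2}\rfloor,r+1;1,\lceil\frac{n-r-1}{2}\rceil-1\big)\Big\}$. (iv) If $r\geq 2$ and $f(n,r)=g(n,r)$, then $e(G)\leq f(n,r)$, with equality if and only if $G\in\Big\{K_{n-\lfloor\frac{n-1}{r+1}\rfloor,\lfloor\frac{n-1}{r+1}\rfloor},\ D\big(\lceil\frac{n-r-1}{2}\rceil,r+1;1,\lfloor\frac{n-r-1}{2}\rfloor-1\big),\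 D\big(\lfloor\frac{n-r-1}{2}\rfloor,r+1;1,\lceil\frac{n-r-1}{2}\rceil-1\big)\Big\}$.
   Context: All graphs are finite and simple; $e(G)$ is the number of edges. For $S\subseteq V(G)$, $N_G(S)$ is the union of the neighborhoods of vertices in $S$. The binding number of $G$ is $b(G)=\min\{|N_G(S)|/|S|:\emptyset\neq S\subseteq V(G),\ N_G(S)\neq V(G)\}$. $K_{a,b}$ is the complete bipartite graph with parts of sizes $a,b$. For positive integers $p_1,p_2,q_1,q_2$, the double nested graph $D(p_1,p_2;q_1,q_2)$ is the bipartite graph with parts $X=X_1\cup X_2$ and $Y=Y_1\cup Y_2$ (disjoint independent sets with $|X_i|=p_i$, $|Y_i|=q_i$), in which every vertex of $X_1$ is adjacent to every vertex of $Y_1\cup Y_2$, every vertex of $X_2$ is adjacent to every vertex of $Y_1$, and there are no other edges. *)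

theory Defs
  imports Complex_Main "Graph_Theory.Graph_Theory"
begin

text \<open>
  A finite simple graph is an element of locale \<^locale>\<open>pair_graph\<close>, i.e. a finite loop-free
  symmetric digraph without parallel arcs. Every undirected edge is therefore represented by two
  opposite arcs, so edges are counted as unordered pairs of end points.
\<close>

definition num_edges :: "'a pair_pre_digraph \<Rightarrow> nat" where
  "num_edges G = card ((\<lambda>(u, v). {u, v}) ` parcs G)"

definition nbhd :: "'a pair_pre_digraph \<Rightarrow> 'a set \<Rightarrow> 'a set" where
  "nbhd G S = (\<Union>v\<in>S. {u. (v, u) \<in> parcs G})"

definition no_isolated :: "'a pair_pre_digraph \<Rightarrow> bool" where
  "no_isolated G \<longleftrightarrow> (\<forall>v\<in>pverts G. nbhd G {v} \<noteq> {})"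

definition bipartite :: "'a pair_pre_digraph \<Rightarrow> bool" where
  "bipartite G \<longleftrightarrow> (\<exists>X Y. pverts G = X \<union> Y \<and> X \<inter> Y = {} \<and> parcs G \<subseteq> X \<times> Y \<union> Y \<times> X)"

text \<open>
  For a finite simple graph with at least one vertex the set below is finite and nonempty:
  \<open>S = {v}\<close> is always admissible, since \<open>v\<close> is not its own neighbour.
\<close>

definition binding_number :: "'a pair_pre_digraph \<Rightarrow> real" where
  "binding_number G = Min {real (card (nbhd G S)) / real (card S) | S.
     S \<noteq> {} \<and> S \<subseteq> pverts G \<and> nbhd G S \<noteq> pverts G}"

datatype dn_vertex = VX1 nat | VX2 nat | VY1 nat | VY2 nat

definition double_nested :: "nat \<Rightarrow> nat \<Rightarrow> nat \<Rightarrow> nat \<Rightarrow> dn_vertex pair_pre_digraph" where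
  "double_nested p1 p2 q1 q2 =
    (let X1 = VX1 ` {..<p1}; X2 = VX2 ` {..<p2}; Y1 = VY1 ` {..<q1}; Y2 = VY2 ` {..<q2};
         E = X1 \<times> (Y1 \<union> Y2) \<union> X2 \<times> Y1
     in \<lparr> pverts = X1 \<union> X2 \<union> Y1 \<union> Y2, parcs = E \<union> E\<inverse> \<rparr>)"

abbreviation graph_iso :: "'a pair_pre_digraph \<Rightarrow> 'b pair_pre_digraph \<Rightarrow> bool" where
  "graph_iso G H \<equiv> digraph_iso (with_proj G) (with_proj H)"

text \<open>
  \<^const>\<open>complete_bipartite_digraph\<close> is a predicate on graphs that characterises the complete
  bipartite graph with parts of the given sizes up to isomorphism.
\<close>

abbreviation is_complete_bipartite :: "nat \<Rightarrow> nat \<Rightarrow> 'a pair_pre_digraph \<Rightarrow> bool" where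
  "is_complete_bipartite a b G \<equiv> complete_bipartite_digraph a b (with_proj G)"

definition f_bound :: "nat \<Rightarrow> nat \<Rightarrow> nat" where
  "f_bound n r = nat \<lfloor>(real n - 1) / (real r + 1)\<rfloor> * (n - nat \<lfloor>(real n - 1) / (real r + 1)\<rfloor>)"

definition g_bound :: "nat \<Rightarrow> nat \<Rightarrow> nat" where
  "g_bound n r =
     nat \<lfloor>(real n - real r - 1) / 2\<rfloor> * nat \<lceil>(real n - real r - 1) / 2\<rceil> + r + 1"

end

theory Submission
  imports Defs
begin

text \<open>
  A set witnessing \<open>b(G) < 1/r\<close> splits along the bipartition \<open>(X, Y)\<close>, so after exchanging \<open>X\<close>
  and \<open>Y\<close> some \<open>A \<subseteq> X\<close> with \<open>t = |N(A)|\<close> satisfies \<open>|A| \<ge> rt + 1\<close>. With \<open>x = |X|\<close> and \<open>y = |Y|\<close>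
  this gives \<open>e(G) \<le> xy - (rt + 1)(y - t)\<close>, a convex quadratic in \<open>t\<close>. The end point \<open>t = y\<close> gives \<open>f\<close>
  and complete bipartite graphs, and \<open>t = 1\<close> gives \<open>g\<close> and double nested graphs. An intermediate \<open>t\<close>
  is never optimal: if \<open>x \<ge> ry + 1\<close>, compare with \<open>t = 1\<close> and \<open>t = y\<close>. Otherwise write
  \<open>x = rT + 1 + i\<close> with \<open>1 \<le> i \<le> r\<close>, push \<open>t\<close> to \<open>1\<close> or \<open>T\<close>, and note that for fixed \<open>i\<close> the value
  at \<open>t = T\<close> is again convex in \<open>T\<close>. At the largest admissible \<open>T\<close> it is below \<open>f\<close>; this is where
  \<open>n \<ge> r\<^sup>2 + r + 1\<close> is needed.
\<close>

section \<open>Integer estimates for the quadratic bounds\<close>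

lemma convex_quadratic_less_max:
  fixes a b c s t u :: int
  assumes "a > 0" "s < t" "t < u"
  shows "a * t\<^sup>2 + b * t + c < max (a * s\<^sup>2 + b * s + c) (a * u\<^sup>2 + b * u + c)"
proof (rule ccontr)
  assume "\<not> ?thesis"
  then have 1: "a * s\<^sup>2 + b * s + c \<le> a * t\<^sup>2 + b * t + c"
    and 2: "a * u\<^sup>2 + b * u + c \<le> a * t\<^sup>2 + b * t + c" by auto
  \<comment> \<open>The factor a(t + s) + b is the slope of the chord from s to t, and a(u + t) + b
    the slope from t to u. If t were no worse than both ends, the slopes would not increase,
    although they differ by a(u - s) > 0.\<close>
  from 1 have "0 \<le> (t - s) * (a * (t + s) + b)"
    by (simp add: algebra_simps power2_eq_square)
  with assms have 3: "0 \<le> a * (t + s) + b"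
    by (simp add: zero_le_mult_iff)
  from 2 have "(u - t) * (a * (u + t) + b) \<le> 0"
    by (simp add: algebra_simps power2_eq_square)
  with assms have "a * (u + t) + b \<le> 0"
    by (simp add: mult_le_0_iff)
  with 3 have "a * (u - s) \<le> 0"
    by (simp add: algebra_simps)
  with assms show False
    by (simp add: mult_le_0_iff)
qed

text \<open>The difference of the two products is (k - y)(n - k - y), and its second factor is at
  least n - 2k > 0. In the case t = y this yields both the bound by f and the uniqueness of y =
  k.\<close>

lemma product_mono_below_half:
  fixes k n y :: int
  assumes "y \<le> k" "2 * k < n"
  shows "y * (n - y) \<le> k * (n - k)" and "y * (n - y) = k * (n - k) \<longleftrightarrow> y = k"
proof -
  have *: "k * (n - k) - y * (n - y) = (k - y) * (n - k - y)"
    by (simp add: algebra_simps)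
  have "0 \<le> (k - y) * (n - k - y)"
    using assms by (intro mult_nonneg_nonneg) auto
  then show "y * (n - y) \<le> k * (n - k)"
    using * by linarith
  show "y * (n - y) = k * (n - k) \<longleftrightarrow> y = k"
    using * assms by auto
qed

text \<open>Here k and j are quotient and remainder of n - 1 by r + 1, and the bounded quantity is
  the edge bound at t = T for x = rT + 1 + i and y = n - x. Lowering T to 1 with i fixed also
  changes x to r + 1 + i, so \<open>M\<close> has to dominate the t = 1 values of every split of
  n.\<close>

lemma interior_less_max_aux:
  fixes r k j n T i F M :: int
  assumes "r \<ge> 1" "k \<ge> r" "0 \<le> j" "j \<le> r" and n: "n = k * (r + 1) + 1 + j"
    and "2 \<le> T" and i: "1 \<le> i" "i \<le> r" and T: "T < n - (r * T + 1 + i)"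
    and F: "F = k * (n - k)"
    and M: "\<And>x y. x + y = n \<Longrightarrow> x * y - (r + 1) * (y - 1) \<le> M"
  shows "i * (n - (r * T + 1 + i)) + (r * T + 1) * T < max F M"
proof -
  define q where "q z = r * z\<^sup>2 + (1 - r * i) * z + i * (n - 1 - i)" for z :: int
  have q: "q z = i * (n - (r * z + 1 + i)) + (r * z + 1) * z" for z
    by (simp add: q_def algebra_simps power2_eq_square)
  have q1: "q 1 \<le> M"
    using M[of "r + 1 + i" "n - (r + 1 + i)"] unfolding q by (simp add: algebra_simps)
  \<comment> \<open>The condition T < y reads (r + 1)T <= k(r + 1) + (j - 1 - i), where j - 1 - i
    lies between -(r + 1) and r. Hence \<open>K\<close> is the largest T allowed, and the sign of j
    - 1 - i decides between k and k - 1.\<close>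
  define K where "K = (if i < j then k else k - 1)"
  have "T \<le> K"
  proof -
    have *: "(r + 1) * T \<le> k * (r + 1) + j - 1 - i"
      using T n by (simp add: algebra_simps)
    show ?thesis
    proof (cases "i < j")
      case True
      have "(r + 1) * T < (r + 1) * (k + 1)"
        using * assms by (simp add: algebra_simps)
      then have "T < k + 1"
        using \<open>r \<ge> 1\<close> by simp
      with True show ?thesis by (simp add: K_def)
    next
      case False
      have "(r + 1) * T < (r + 1) * k"
        using * False assms by (simp add: algebra_simps)
      then have "T < k"
        using \<open>r \<ge> 1\<close> by simp
      with False show ?thesis by (simp add: K_def)
    qed
  qed
  have qK: "q K < F"
  \<comment> \<open>In both cases F - q(K) splits into terms whose signs follow from i <= r <= k.
    When i < j, even i < k holds, so the product (j - i)(k - i) is positive; otherwise the last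
    summand r(k - 1) + 1 gives strictness.\<close>
  proof (cases "i < j")
    case True
    have "F - q k = (j - i) * (k - i)"
      by (simp add: q F n algebra_simps)
    moreover have "(j - i) * (k - i) > 0"
      using True assms by (intro mult_pos_pos) auto
    ultimately show ?thesis
      using True by (simp add: K_def)
  next
    case False
    have "F - q (k - 1) = (k - i) * j + (r - i) * (k - i) + (r * (k - 1) + 1)"
      by (simp add: q F n algebra_simps)
    moreover have "(k - i) * j \<ge> 0" "(r - i) * (k - i) \<ge> 0" "r * (k - 1) \<ge> 0"
      using assms by (auto intro!: mult_nonneg_nonneg)
    ultimately show ?thesis
      using False by (simp add: K_def)
  qed
  have "q T < max F M"
  proof (cases "T = K")
    case True
    then show ?thesis using qK by simp
  next
    case False
    have "q T < max (q 1) (q K)"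
      unfolding q_def using False \<open>T \<le> K\<close> assms by (intro convex_quadratic_less_max) auto
    then show ?thesis
      using q1 qK by auto
  qed
  then show ?thesis by (simp add: q)
qed

lemma interior_less_max:
  fixes r k j n t x y F M :: int
  assumes "r \<ge> 1" "k \<ge> r" "0 \<le> j" "j \<le> r" and n: "n = k * (r + 1) + 1 + j"
    and t: "2 \<le> t" "t < y" "r * t + 2 \<le> x" "x + y = n"
    and F: "F = k * (n - k)"
    and M: "\<And>x y. x + y = n \<Longrightarrow> x * y - (r + 1) * (y - 1) \<le> M"
  shows "x * y - (r * t + 1) * (y - t) < max F M"
proof -
  define h where "h z = r * z\<^sup>2 + (1 - r * y) * z + (x * y - y)" for z :: int
  have h: "h z = x * y - (r * z + 1) * (y - z)" for z
    by (simp add: h_def algebra_simps power2_eq_square)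
  have h1: "h 1 \<le> M"
    using M[of x y] t unfolding h by simp
  have "h t < max F M"
  \<comment> \<open>If x >= ry + 1, the end point t = y is itself admissible and has value xy, which
    is at most \<open>F\<close>. If not, admissible t stop before y and another right end point is
    needed.\<close>
  proof (cases "r * y + 1 \<le> x")
    case True
    have "(r + 1) * y < (r + 1) * (k + 1)"
      using True t n assms by (simp add: algebra_simps)
    then have "y \<le> k" using \<open>r \<ge> 1\<close> by simp
    moreover have "2 * k < n"
    proof -
      have "k * 2 \<le> k * (r + 1)" using assms by (intro mult_left_mono) auto
      then show ?thesis using n \<open>0 \<le> j\<close> by linarith
    qed
    ultimately have "y * (n - y) \<le> F"
      unfolding F by (rule product_mono_below_half)
    moreover have "h y = y * (n - y)"
      using t by (simp add: h algebra_simps flip: \<open>x + y = n\<close>)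
    moreover have "h t < max (h 1) (h y)"
      unfolding h_def using assms by (intro convex_quadratic_less_max) auto
    ultimately show ?thesis using h1 by auto
  next
    case False
    \<comment> \<open>\<open>T\<close> is the largest t with rt + 2 <= x. The shift by 2 puts the
      remainder \<open>i\<close> in the range 1 to r instead of 0 to r - 1.\<close>
    define T i where "T = (x - 2) div r" and "i = (x - 2) mod r + 1"
    have x: "x = r * T + 1 + i"
      using mult_div_mod_eq[of r "x - 2"] by (simp add: T_def i_def)
    have i: "1 \<le> i" "i \<le> r"
      using \<open>r \<ge> 1\<close> pos_mod_sign[of r "x - 2"] pos_mod_bound[of r "x - 2"]
      unfolding i_def by linarith+
    have "t \<le> T"
      using t zdiv_mono1[of "r * t" "x - 2" r] \<open>r \<ge> 1\<close> by (simp add: T_def)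
    have "r * T < r * y"
      using False x i by linarith
    then have "T < y" using \<open>r \<ge> 1\<close> by simp
    have y: "y = n - (r * T + 1 + i)"
      using t x by simp
    have "i * y + (r * T + 1) * T < max F M"
      unfolding y
      by (rule interior_less_max_aux[OF assms(1-4) n _ i _ F M])
        (use \<open>t \<le> T\<close> t \<open>T < y\<close> y in auto)
    moreover have "h T = i * y + (r * T + 1) * T"
      by (simp add: h x algebra_simps)
    ultimately have hT: "h T < max F M" by simp
    show ?thesis
    proof (cases "t = T")
      case True
      with hT show ?thesis by simp
    next
      case False
      have "h t < max (h 1) (h T)"
        unfolding h_def using False \<open>t \<le> T\<close> assms by (intro convex_quadratic_less_max) auto
      with hT h1 show ?thesis by auto
    qed
  qed
  then show ?thesis by (simp add: h)
qed

text \<open>With k = m div 2 and l = (m + 1) div 2, the deficit kl - uv equals (k - u)(v - k). Since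
  u + v = k + l and l is k or k + 1, the two factors never have opposite signs. Each factor can
  vanish, which is the source of the two double nested graphs.\<close>

lemma balanced_product:
  fixes m u v :: int
  assumes "u + v = m"
  shows "u * v \<le> (m div 2) * ((m + 1) div 2)"
    and "u * v = (m div 2) * ((m + 1) div 2) \<Longrightarrow>
      v = m div 2 \<and> u = (m + 1) div 2 \<or> u = m div 2 \<and> v = (m + 1) div 2"
proof -
  define k where "k = m div 2"
  define l where "l = (m + 1) div 2"
  have m: "m = k + l" and l: "l = k \<or> l = k + 1"
    unfolding k_def l_def by presburger+
  have *: "k * l - u * v = (k - u) * (v - k)"
  proof -
    have l: "l = u + v - k" using m assms by simp
    show ?thesis unfolding l by (simp add: algebra_simps)
  qed
  have "(k - u) * (v - k) \<ge> 0"
    using m l assms by (cases "u \<le> k") (auto simp: zero_le_mult_iff)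
  with * show "u * v \<le> (m div 2) * ((m + 1) div 2)"
    unfolding k_def[symmetric] l_def[symmetric] by simp
  assume "u * v = (m div 2) * ((m + 1) div 2)"
  then have "k * l - u * v = 0"
    unfolding k_def[symmetric] l_def[symmetric] by simp
  then have "u = k \<or> v = k" using * by auto
  then show "v = m div 2 \<and> u = (m + 1) div 2 \<or> u = m div 2 \<and> v = (m + 1) div 2"
    unfolding k_def[symmetric] l_def[symmetric] using m assms by auto
qed

section \<open>Closed forms of f and g, and their comparison for r = 1\<close>

lemma nat_floor_pred_divide:
  assumes "n \<ge> 1"
  shows "nat \<lfloor>(real n - 1) / (real r + 1)\<rfloor> = (n - 1) div (r + 1)"
proof -
  have "(real n - 1) / (real r + 1) = real (n - 1) / real (r + 1)"
    using assms by (simp add: of_nat_diff add.commute)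
  then show ?thesis
    by (simp only: floor_divide_of_nat_eq nat_int)
qed

lemma half_floor_ceiling:
  assumes "n \<ge> r + 1"
  shows "nat \<lfloor>(real n - real r - 1) / 2\<rfloor> = (n - (r + 1)) div 2"
    and "nat \<lceil>(real n - real r - 1) / 2\<rceil> = (n - (r + 1) + 1) div 2"
proof -
  define m where "m = n - (r + 1)"
  have m: "real n - real r - 1 = real m"
    using assms by (simp add: m_def of_nat_diff)
  have "\<lfloor>real m / 2\<rfloor> = int (m div 2)"
    using floor_divide_of_nat_eq[of m 2] by simp
  then show "nat \<lfloor>(real n - real r - 1) / 2\<rfloor> = (n - (r + 1)) div 2"
    unfolding m by (simp add: m_def)
  have "\<lceil>real m / 2\<rceil> = int ((m + 1) div 2)"
    by (cases "even m") (auto elim!: evenE oddE simp: ceiling_eq_iff)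
  then show "nat \<lceil>(real n - real r - 1) / 2\<rceil> = (n - (r + 1) + 1) div 2"
    unfolding m by (simp add: m_def)
qed

text \<open>Splitting by parity, f - g is 2p for n = 2p + 4 and 2p + 2 for n = 2p + 5. At n = 4 both
  values are 3, hence the threshold 5.\<close>

lemma f_bound_greater_g_bound_1:
  fixes n :: nat
  assumes "n \<ge> 5"
  shows "((n - 2) div 2) * ((n - 2 + 1) div 2) + 2 < ((n - 1) div 2) * (n - (n - 1) div 2)"
proof -
  have "\<exists>p. n = 2 * p + 4 \<or> n = 2 * p + 5" using assms by presburger
  then obtain p where "n = 2 * p + 4 \<and> p \<ge> 1 \<or> n = 2 * p + 5" using assms by fastforce
  then show ?thesis
  proof
    assume "n = 2 * p + 4 \<and> p \<ge> 1"
    moreover then have "(n - 2) div 2 = p + 1" "(n - 2 + 1) div 2 = p + 1" "(n - 1) div 2 = p + 1"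
      "n - (n - 1) div 2 = p + 3"  by auto
    ultimately show ?thesis by (auto simp: algebra_simps)
  next
    assume "n = 2 * p + 5"
    moreover then have "(n - 2) div 2 = p + 1" "(n - 2 + 1) div 2 = p + 2" "(n - 1) div 2 = p + 2"
      "n - (n - 1) div 2 = p + 3"  by auto
    ultimately show ?thesis by (auto simp: algebra_simps)
  qed
qed

section \<open>Edge counts and isomorphisms\<close>

lemma num_edges_eq_card:
  assumes "parcs G = E \<union> E\<inverse>" "E \<subseteq> X \<times> Y" "X \<inter> Y = {}"
  shows "num_edges G = card E"
proof -
  have "(\<lambda>(u, v). {u, v}) ` parcs G = (\<lambda>(u, v). {u, v}) ` E"
    unfolding assms(1) by (fastforce simp: insert_commute)
  \<comment> \<open>Because X and Y are disjoint, an unordered pair determines which end point lies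
    in X, so \<open>E\<close> contains exactly one orientation of each edge.\<close>
  moreover have "inj_on (\<lambda>(u, v). {u, v}) E"
    using assms(2,3) by (intro inj_onI) (clarsimp simp: doubleton_eq_iff, blast)
  ultimately show ?thesis
    by (simp add: num_edges_def card_image)
qed

lemma num_edges_complete_bipartite:
  assumes "is_complete_bipartite a b G"
  shows "num_edges G = a * b"
proof -
  obtain U V where "U \<inter> V = {}" "card U = a" "card V = b" "parcs G = U \<times> V \<union> V \<times> U"
    using assms by (auto simp: complete_bipartite_digraph_pair_def)
  then show ?thesis
    by (subst num_edges_eq_card[of _ "U \<times> V" U V]) (auto simp: card_cartesian_product)
qed

lemma num_edges_double_nested:
  "num_edges (double_nested p1 p2 q1 q2) = p1 * (q1 + q2) + p2 * q1"
proof -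
  define X1 X2 Y1 Y2 where "X1 = VX1 ` {..<p1}" and "X2 = VX2 ` {..<p2}"
    and "Y1 = VY1 ` {..<q1}" and "Y2 = VY2 ` {..<q2}"
  note defs = this
  have cards: "card X1 = p1" "card X2 = p2" "card Y1 = q1" "card Y2 = q2"
    by (auto simp: defs card_image inj_on_def)
  have fin: "finite X1" "finite X2" "finite Y1" "finite Y2"
    by (auto simp: defs)
  have disj: "X1 \<inter> X2 = {}" "Y1 \<inter> Y2 = {}" "(X1 \<union> X2) \<inter> (Y1 \<union> Y2) = {}"
    by (auto simp: defs)
  have "num_edges (double_nested p1 p2 q1 q2) = card (X1 \<times> (Y1 \<union> Y2) \<union> X2 \<times> Y1)"
    using disj
    by (intro num_edges_eq_card[of _ _ "X1 \<union> X2" "Y1 \<union> Y2"])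
      (auto simp: double_nested_def Let_def defs)
  also have "\<dots> = card (X1 \<times> (Y1 \<union> Y2)) + card (X2 \<times> Y1)"
    using fin disj by (intro card_Un_disjoint) auto
  also have "\<dots> = p1 * (q1 + q2) + p2 * q1"
    using fin disj by (simp add: card_cartesian_product card_Un_disjoint cards)
  finally show ?thesis .
qed

lemma num_edges_iso:
  assumes "graph_iso G H"
  shows "num_edges G = num_edges H"
proof -
  obtain f where f: "pre_digraph.digraph_isomorphism (with_proj G) f" "with_proj H = app_iso f (with_proj G)"
    using assms by (auto simp: digraph_iso_def)
  interpret wf_digraph "with_proj G"
    using f(1) by (simp add: pre_digraph.digraph_isomorphism_def)
  define \<phi> where "\<phi> = iso_verts f"
  have inj: "inj_on \<phi> (pverts G)"
    using f(1) by (simp add: pre_digraph.digraph_isomorphism_def \<phi>_def)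
  have sub: "parcs G \<subseteq> pverts G \<times> pverts G"
    using wellformed by fastforce
  have "parcs H = (\<lambda>(u, v). (\<phi> u, \<phi> v)) ` parcs G"
    using arcs_ends_app_iso_eq[OF f(1)] f(2) by (metis with_proj_simps(3) \<phi>_def)
  then have "(\<lambda>(u, v). {u, v}) ` parcs H = (`) \<phi> ` ((\<lambda>(u, v). {u, v}) ` parcs G)"
    by (auto simp: image_image split_beta)
  \<comment> \<open>An injective vertex map is injective on sets of vertices, hence on edges viewed
    as unordered pairs.\<close>
  moreover have "inj_on ((`) \<phi>) ((\<lambda>(u, v). {u, v}) ` parcs G)"
    by (rule inj_on_subset[OF inj_on_image_Pow[OF inj]]) (use sub in auto)
  ultimately show ?thesis
    by (simp add: num_edges_def card_image)
qed

text \<open>Numbering each of the four classes separately gives the vertex map. The constructors of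
  \<open>dn_vertex\<close> keep the images of different classes apart, so injectivity is only needed
  within a class.\<close>

lemma iso_double_nested:
  assumes wf: "wf_digraph (with_proj G)"
    and verts: "pverts G = X1 \<union> X2 \<union> Y1 \<union> Y2" and fin: "finite (pverts G)"
    and disj: "X1 \<inter> X2 = {}" "Y1 \<inter> Y2 = {}" "(X1 \<union> X2) \<inter> (Y1 \<union> Y2) = {}"
    and arcs: "parcs G = (X1 \<times> (Y1 \<union> Y2) \<union> X2 \<times> Y1) \<union> (X1 \<times> (Y1 \<union> Y2) \<union> X2 \<times> Y1)\<inverse>"
  shows "graph_iso G (double_nested (card X1) (card X2) (card Y1) (card Y2))"
proof -
  have "finite X1" "finite X2" "finite Y1" "finite Y2"
    using fin verts by auto
  then obtain a b c d where "bij_betw a X1 {..<card X1}" "bij_betw b X2 {..<card X2}"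
    "bij_betw c Y1 {..<card Y1}" "bij_betw d Y2 {..<card Y2}"
    by (metis ex_bij_betw_finite_nat lessThan_atLeast0)
  note bij = this
  define \<phi> where "\<phi> v = (if v \<in> X1 then VX1 (a v) else if v \<in> X2 then VX2 (b v)
    else if v \<in> Y1 then VY1 (c v) else VY2 (d v))" for v
  have \<phi>: "v \<in> X1 \<Longrightarrow> \<phi> v = VX1 (a v)" "v \<in> X2 \<Longrightarrow> \<phi> v = VX2 (b v)"
    "v \<in> Y1 \<Longrightarrow> \<phi> v = VY1 (c v)" "v \<in> Y2 \<Longrightarrow> \<phi> v = VY2 (d v)" for v
    using disj by (auto simp: \<phi>_def)
  have inj: "inj_on \<phi> (pverts G)"
    unfolding verts
    by (rule inj_onI) (use bij in \<open>auto simp: \<phi> bij_betw_def dest: inj_onD\<close>)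
  have "\<phi> ` X1 = VX1 ` (a ` X1)" "\<phi> ` X2 = VX2 ` (b ` X2)"
    "\<phi> ` Y1 = VY1 ` (c ` Y1)" "\<phi> ` Y2 = VY2 ` (d ` Y2)"
    unfolding image_image by (auto intro!: image_cong simp: \<phi>)
  then have im: "\<phi> ` X1 = VX1 ` {..<card X1}" "\<phi> ` X2 = VX2 ` {..<card X2}"
    "\<phi> ` Y1 = VY1 ` {..<card Y1}" "\<phi> ` Y2 = VY2 ` {..<card Y2}"
    using bij by (simp_all add: bij_betw_def)
  have sub: "parcs G \<subseteq> pverts G \<times> pverts G"
    by (auto simp: arcs verts)
  \<comment> \<open>A digraph isomorphism also carries an arc map and the end point functions of the
    target. Arcs are pairs here, so these are the induced map on pairs and the two
    projections.\<close>
  define f where "f = \<lparr>iso_verts = \<phi>, iso_arcs = map_prod \<phi> \<phi>, iso_head = snd, iso_tail = fst\<rparr>"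
  have "pre_digraph.digraph_isomorphism (with_proj G) f"
    unfolding pre_digraph.digraph_isomorphism_def
    using wf inj inj_on_subset[OF map_prod_inj_on[OF inj inj] sub] by (auto simp: f_def)
  moreover have "with_proj (double_nested (card X1) (card X2) (card Y1) (card Y2)) = app_iso f (with_proj G)"
  proof -
    have "map_prod \<phi> \<phi> ` (A \<times> B) = \<phi> ` A \<times> \<phi> ` B" for A B
      by auto
    then show ?thesis
      unfolding double_nested_def Let_def app_iso_def f_def with_proj_def
      by (simp add: verts arcs image_Un im converse_Un converse_Times)
  qed
  ultimately show ?thesis
    by (auto simp: digraph_iso_def)
qed

section \<open>From a small binding number to the extremal graphs\<close>

lemma binding_number_lessE:
  assumes "pair_graph G" "pverts G \<noteq> {}" "binding_number G < c"
  obtains S where "S \<noteq> {}" "S \<subseteq> pverts G" "real (card (nbhd G S)) < c * real (card S)"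
proof -
  interpret pair_graph G by fact
  let ?\<S> = "{S. S \<noteq> {} \<and> S \<subseteq> pverts G \<and> nbhd G S \<noteq> pverts G}"
  let ?b = "\<lambda>S. real (card (nbhd G S)) / real (card S)"
  obtain v where "v \<in> pverts G" using assms(2) by auto
  \<comment> \<open>Loop-freeness makes the singleton admissible, so the minimum ranges over a
    finite nonempty family and is attained.\<close>
  moreover have "v \<notin> nbhd G {v}" by (auto simp: nbhd_def dest: no_loops')
  ultimately have "{v} \<in> ?\<S>" by auto
  moreover have "finite ?\<S>"
    by (rule finite_subset[of _ "Pow (pverts G)"]) (auto simp: pair_finite_verts)
  then have "finite (?b ` ?\<S>)" by (rule finite_imageI)
  moreover have "binding_number G = Min (?b ` ?\<S>)"
    unfolding binding_number_def by (simp add: setcompr_eq_image)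
  ultimately have "binding_number G \<in> ?b ` ?\<S>"
    using Min_in[of "?b ` ?\<S>"] by (metis (lifting) empty_iff empty_is_image)
  then obtain S where S: "S \<in> ?\<S>" "binding_number G = ?b S" by blast
  then have "card S > 0"
    using finite_subset[OF _ pair_finite_verts] by (auto simp: card_gt_0_iff)
  moreover have "?b S < c" using S assms(3) by simp
  ultimately have "real (card (nbhd G S)) < c * real (card S)"
    by (simp add: pos_divide_less_eq)
  with S show ?thesis by (intro that[of S]) auto
qed

text \<open>\<open>E\<close> orients every edge from X to Y, so the image of \<open>A\<close> under
  \<open>E\<close> is N(A). The conclusion leaves open which of f and g is larger, so that every
  case of the theorem can be read off from it. The bound \<open>n \<ge> r + 4\<close> comes from x
  >= r + 2 and y >= 2; it excludes the double nested alternative for r = 1 when f = g.\<close>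

lemma extremal_trichotomy:
  fixes r n :: nat and G :: "'a pair_pre_digraph"
  defines "k \<equiv> (n - 1) div (r + 1)" and "m \<equiv> n - (r + 1)"
  assumes r: "r \<ge> 1" and n: "n \<ge> r\<^sup>2 + r + 1"
    and G: "pair_graph G" "card (pverts G) = n" "no_isolated G"
    and verts: "pverts G = X \<union> Y" "X \<inter> Y = {}"
    and arcs: "parcs G = E \<union> E\<inverse>" "E \<subseteq> X \<times> Y"
    and A: "A \<subseteq> X" "A \<noteq> {}" "r * card (E `` A) < card A"
  shows "card E < max (k * (n - k)) ((m div 2) * ((m + 1) div 2) + r + 1) \<or>
    card E = k * (n - k) \<and> is_complete_bipartite (n - k) k G \<or>
    card E = (m div 2) * ((m + 1) div 2) + r + 1 \<and> n \<ge> r + 4 \<and>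
      (graph_iso G (double_nested ((m + 1) div 2) (r + 1) 1 (m div 2 - 1)) \<or>
       graph_iso G (double_nested (m div 2) (r + 1) 1 ((m + 1) div 2 - 1)))"
proof -
  interpret pair_graph G by fact
  define x y a N t where "x = card X" and "y = card Y" and "a = card A"
    and "N = E `` A" and "t = card N"
  note defs = this
  have fin: "finite X" "finite Y" "finite A" "finite N" "finite E"
    using pair_finite_verts pair_finite_arcs verts arcs A
    by (auto simp: N_def dest: finite_subset)
  have "N \<subseteq> Y" using arcs by (auto simp: N_def)
  have xy: "x + y = n"
    using G verts fin by (simp add: defs card_Un_disjoint)
  have nb: "\<exists>u. (v, u) \<in> parcs G" if "v \<in> pverts G" for v
    using G that by (auto simp: no_isolated_def nbhd_def)
  have "N \<noteq> {}"
  proof -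
    obtain v where "v \<in> A" using A by auto
    with nb obtain u where "(v, u) \<in> parcs G" using A verts by blast
    then have "(v, u) \<in> E" using \<open>v \<in> A\<close> A arcs verts by auto
    with \<open>v \<in> A\<close> show ?thesis by (auto simp: N_def)
  qed
  then have "t \<ge> 1" using fin by (simp add: t_def Suc_leI card_gt_0_iff)
  have "t \<le> y" using \<open>N \<subseteq> Y\<close> fin by (simp add: defs card_mono)
  have "a \<le> x" using A fin by (simp add: defs card_mono)
  have a: "a \<ge> r * t + 1" using A by (simp add: defs)
  \<comment> \<open>In this form, r(r + 1) <= n - 1, the hypothesis on n reaches the quadratic
    estimates.\<close>
  have rk: "r \<le> k"
    using n by (simp add: k_def less_eq_div_iff_mult_less_eq power2_eq_square algebra_simps)
  have n_eq: "n = k * (r + 1) + 1 + (n - 1) mod (r + 1)"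
    using n div_mult_mod_eq[of "n - 1" "r + 1"] unfolding k_def by linarith
  have "k * (r + 1) \<le> n - 1" by (simp only: k_def div_times_less_eq_dividend)
  moreover have "k * 2 \<le> k * (r + 1)" using r by (intro mult_left_mono) auto
  ultimately have k2: "2 * k < n" using n by linarith
  define F M where "F = k * (n - k)" and "M = (m div 2) * ((m + 1) div 2) + r + 1"
  have F: "int F = int k * (int n - int k)"
    using k2 by (simp add: F_def of_nat_diff)
  have M: "int M = (int m div 2) * ((int m + 1) div 2) + int r + 1"
    unfolding M_def by (simp add: zdiv_int add.commute)
  have m: "int m = int n - int r - 1" using n by (simp add: m_def of_nat_diff)
  have g: "x * y - (int r + 1) * (y - 1) \<le> int M" if "x + y = int n" for x y
  proof -
    \<comment> \<open>The t = 1 value is (x - r - 1)y + r + 1, and the two factors of the product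
      sum to m.\<close>
    have "(x - int r - 1) * y \<le> (int m div 2) * ((int m + 1) div 2)"
      by (rule balanced_product(1)) (use that m in simp)
    then show ?thesis by (simp add: M algebra_simps)
  qed
  have "card E < max F M \<or> card E = F \<and> is_complete_bipartite (n - k) k G \<or>
    card E = M \<and> n \<ge> r + 4 \<and>
      (graph_iso G (double_nested ((m + 1) div 2) (r + 1) 1 (m div 2 - 1)) \<or>
       graph_iso G (double_nested (m div 2) (r + 1) 1 ((m + 1) div 2 - 1)))"
  proof (cases "t = y")
    case True
    have "y * (r + 1) \<le> n - 1"
      using True a \<open>a \<le> x\<close> xy by (simp add: algebra_simps)
    then have "y \<le> k" by (simp add: k_def less_eq_div_iff_mult_less_eq)
    have cE: "card E \<le> x * y"
      using card_mono[OF _ arcs(2)] fin by (simp add: card_cartesian_product defs)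
    have x: "int n - int y = int x" using xy by simp
    have "int y * int x \<le> int F" "int y * int x = int F \<longleftrightarrow> y = k"
      using product_mono_below_half[of "int y" "int k" "int n"] \<open>y \<le> k\<close> k2
      unfolding x F by simp_all
    then have "x * y \<le> F" "x * y = F \<longleftrightarrow> y = k"
      by (simp_all add: mult.commute flip: of_nat_mult)
    show ?thesis
    proof (cases "card E = F")
      case True
      with cE \<open>x * y \<le> F\<close> have "card E = x * y" by simp
      then have "E = X \<times> Y"
        using arcs fin by (intro card_subset_eq) (auto simp: card_cartesian_product defs)
      moreover have "y = k" using \<open>card E = x * y\<close> True \<open>x * y = F \<longleftrightarrow> y = k\<close> by simp
      moreover have "x = n - y" using xy by simp
      ultimately have "card X = n - k" "card Y = k" "parcs G = X \<times> Y \<union> Y \<times> X"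
        using arcs by (auto simp: defs)
      then have "is_complete_bipartite (n - k) k G"
        unfolding complete_bipartite_digraph_pair_def using verts pair_finite_verts by blast
      with True show ?thesis by simp
    next
      case False
      with cE \<open>x * y \<le> F\<close> have "card E < max F M" by linarith
      then show ?thesis by simp
    qed
  next
    case False
    then have "t < y" using \<open>t \<le> y\<close> by simp
    \<comment> \<open>A vertex of Y outside N(A) is not isolated, so it has a neighbour in X outside
      \<open>A\<close>. Thus \<open>A\<close> is a proper subset of X and x >= rt + 2, one more than
      the size of \<open>A\<close> alone gives.\<close>
    have "N \<noteq> Y" using False unfolding t_def y_def by blast
    then obtain w where w: "w \<in> Y" "w \<notin> N" using \<open>N \<subseteq> Y\<close> by blast
    then obtain u where "(w, u) \<in> parcs G" using nb verts by blast
    then have "(u, w) \<in> E" using w arcs verts by auto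
    then have "u \<in> X - A" using w arcs by (auto simp: N_def)
    then have "A \<subset> X" using A by auto
    then have "a < x" using fin by (simp add: defs psubset_card_mono)
    \<comment> \<open>The largest set of X-Y edges in which all neighbours of \<open>A\<close> lie
      in \<open>N\<close>.\<close>
    define E' where "E' = A \<times> N \<union> (X - A) \<times> Y"
    have EE': "E \<subseteq> E'" using arcs by (auto simp: E'_def N_def)
    have "finite E'" using fin by (simp add: E'_def)
    have "card E' = card (A \<times> N) + card ((X - A) \<times> Y)"
      unfolding E'_def using fin by (intro card_Un_disjoint) auto
    also have "\<dots> = a * t + (x - a) * y"
      using A fin by (simp add: card_cartesian_product card_Diff_subset defs)
    finally have "int (card E') = int a * int t + (int x - int a) * int y"
      using \<open>a \<le> x\<close> by (simp add: of_nat_diff)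
    then have cE': "int (card E') = int x * int y - int a * (int y - int t)"
      by (simp add: algebra_simps)
    have cE: "card E \<le> card E'"
      using EE' \<open>finite E'\<close> by (simp add: card_mono)
    have "(int r * int t + 1) * (int y - int t) \<le> int a * (int y - int t)"
      using a \<open>t < y\<close> by (intro mult_right_mono) (auto simp flip: of_nat_mult)
    then have bnd: "int (card E) \<le> int x * int y - (int r * int t + 1) * (int y - int t)"
      using cE cE' by linarith
    have xge: "x \<ge> r * t + 2" using \<open>a < x\<close> a by simp
    show ?thesis
    proof (cases "t = 1")
      case False
      have "int x * int y - (int r * int t + 1) * (int y - int t) < max (int F) (int M)"
      proof (rule interior_less_max[OF _ _ _ _ _ _ _ _ _ F g])
        show "int n = int k * (int r + 1) + 1 + int ((n - 1) mod (r + 1))"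
          using arg_cong[OF n_eq, of int] by (simp add: algebra_simps)
        show "int r * int t + 2 \<le> int x"
          using xge by (simp flip: of_nat_mult)
        have "(n - 1) mod (r + 1) < r + 1" by (rule mod_less_divisor) simp
        then show "int ((n - 1) mod (r + 1)) \<le> int r" by linarith
      qed (use r rk \<open>t \<ge> 1\<close> False \<open>t < y\<close> xy in auto)
      with bnd have "card E < max F M" by (simp flip: of_nat_max)
      then show ?thesis by simp
    next
      case True
      have "card E \<le> M"
        using bnd g[of "int x" "int y"] True xy by simp
      show ?thesis
      proof (cases "card E = M")
        case eq: True
        have g': "int x * int y - (int r + 1) * (int y - 1) \<le> int M"
          using g[of "int x" "int y"] xy by simp
        \<comment> \<open>Equality leaves no slack: xy - (r + 1)(y - 1) <= M = e(G) <= xy - a(y -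
          1). As y > 1, this forces a = r + 1, and then \<open>E\<close> must fill
          \<open>E'\<close>.\<close>
        have "(int a - (int r + 1)) * (int y - 1) \<le> 0"
          using g' cE cE' eq \<open>t = 1\<close> by (simp add: algebra_simps)
        then have "a \<le> r + 1"
          using \<open>t = 1\<close> \<open>t < y\<close> by (simp add: mult_le_0_iff)
        then have ar: "a = r + 1" using a \<open>t = 1\<close> by simp
        have "int (card E') = int x * int y - (int r + 1) * (int y - 1)"
          using cE' \<open>t = 1\<close> ar by (simp add: add.commute)
        then have cE'M: "card E' = M" "int x * int y - (int r + 1) * (int y - 1) = int M"
          using g' cE eq by linarith+
        then have "E = E'"
          using EE' \<open>finite E'\<close> eq by (intro card_subset_eq) auto
        have "(int x - int r - 1) * int y = (int m div 2) * ((int m + 1) div 2)"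
          using cE'M(2) by (simp add: M algebra_simps)
        then have "int y = int m div 2 \<and> int x - int r - 1 = (int m + 1) div 2 \<or>
            int x - int r - 1 = int m div 2 \<and> int y = (int m + 1) div 2"
          using m xy by (intro balanced_product(2)) auto
        moreover have "int m div 2 = int (m div 2)" "(int m + 1) div 2 = int ((m + 1) div 2)"
          by (simp_all add: zdiv_int add.commute)
        moreover have "int x - int r - 1 = int (x - (r + 1))"
          using xge \<open>t = 1\<close> by simp
        ultimately have sizes: "y = m div 2 \<and> x - (r + 1) = (m + 1) div 2 \<or>
            x - (r + 1) = m div 2 \<and> y = (m + 1) div 2"
          by (simp only: of_nat_eq_iff)
        \<comment> \<open>The classes are X1 = X - A, X2 = A, Y1 = N(A), which is a single vertex,
          and Y2 = Y - N(A).\<close>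
        have "graph_iso G (double_nested (card (X - A)) (card A) (card N) (card (Y - N)))"
        proof (rule iso_double_nested)
          show "pverts G = (X - A) \<union> A \<union> N \<union> (Y - N)"
            using verts A \<open>N \<subseteq> Y\<close> by blast
          have "E = (X - A) \<times> (N \<union> (Y - N)) \<union> A \<times> N"
            unfolding \<open>E = E'\<close> E'_def using \<open>N \<subseteq> Y\<close> by blast
          with arcs(1) show "parcs G = ((X - A) \<times> (N \<union> (Y - N)) \<union> A \<times> N) \<union>
              ((X - A) \<times> (N \<union> (Y - N)) \<union> A \<times> N)\<inverse>"
            by simp
          show "(X - A \<union> A) \<inter> (N \<union> (Y - N)) = {}"
            using verts A \<open>N \<subseteq> Y\<close> by blast
        qed (use pair_finite_verts wf_digraph in auto)
        moreover have "card (X - A) = x - (r + 1)" "card A = r + 1" "card N = 1" "card (Y - N) = y - 1"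
          using A \<open>N \<subseteq> Y\<close> fin ar \<open>t = 1\<close> by (simp_all add: defs card_Diff_subset)
        ultimately have "graph_iso G (double_nested (x - (r + 1)) (r + 1) 1 (y - 1))"
          by simp
        moreover have "n \<ge> r + 4" using xge \<open>t = 1\<close> \<open>t < y\<close> xy by simp
        ultimately show ?thesis using eq sizes by metis
      next
        case False
        with \<open>card E \<le> M\<close> have "card E < max F M" by linarith
        then show ?thesis by simp
      qed
    qed
  qed
  then show ?thesis by (simp add: F_def M_def)
qed

text \<open>The neighbourhoods of \<open>S \<inter> X\<close> and \<open>S \<inter> Y\<close> lie on
  opposite sides and are disjoint. So r|N(S)| < |S| is a sum over the two sides, and the strict
  inequality holds on at least one of them; if that side is Y, the roles are exchanged by passing to
  the converse of \<open>E\<close>.\<close>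

lemma extremal_cases:
  fixes r n :: nat and G :: "'a pair_pre_digraph"
  defines "k \<equiv> (n - 1) div (r + 1)" and "m \<equiv> n - (r + 1)"
  assumes r: "r \<ge> 1" and n: "n \<ge> r\<^sup>2 + r + 1"
    and G: "pair_graph G" "card (pverts G) = n" "bipartite G" "no_isolated G"
    and b: "binding_number G < 1 / real r"
  shows "num_edges G < max (k * (n - k)) ((m div 2) * ((m + 1) div 2) + r + 1) \<or>
    num_edges G = k * (n - k) \<and> is_complete_bipartite (n - k) k G \<or>
    num_edges G = (m div 2) * ((m + 1) div 2) + r + 1 \<and> n \<ge> r + 4 \<and>
      (graph_iso G (double_nested ((m + 1) div 2) (r + 1) 1 (m div 2 - 1)) \<or>
       graph_iso G (double_nested (m div 2) (r + 1) 1 ((m + 1) div 2 - 1)))"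
proof -
  interpret pair_graph G by fact
  obtain X Y where XY: "pverts G = X \<union> Y" "X \<inter> Y = {}" "parcs G \<subseteq> X \<times> Y \<union> Y \<times> X"
    using G by (auto simp: bipartite_def)
  define E where "E = parcs G \<inter> X \<times> Y"
  have "parcs G = E \<union> E\<inverse>"
    using XY by (auto simp: E_def dest: arcs_symmetric)
  then have arcs: "parcs G = E \<union> E\<inverse>" "E \<subseteq> X \<times> Y"
    by (auto simp: E_def)
  then have arcs': "parcs G = E\<inverse> \<union> (E\<inverse>)\<inverse>" "E\<inverse> \<subseteq> Y \<times> X" by auto
  have e: "num_edges G = card E" "num_edges G = card (E\<inverse>)"
    using num_edges_eq_card[OF arcs XY(2)] num_edges_eq_card[OF arcs'] XY(2) by (auto simp: Int_commute)
  have "pverts G \<noteq> {}" using G n by auto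
  with binding_number_lessE[OF G(1) _ b] obtain S
    where S: "S \<noteq> {}" "S \<subseteq> pverts G" "real (card (nbhd G S)) < 1 / real r * real (card S)"
    by metis
  then have "real r * real (card (nbhd G S)) < real (card S)"
    using r by (simp add: field_simps)
  then have S': "r * card (nbhd G S) < card S"
    by (simp flip: of_nat_mult)
  have fin: "finite X" "finite Y" "finite S"
    using pair_finite_verts XY S by (auto dest: finite_subset)
  have "nbhd G S = E `` (S \<inter> X) \<union> E\<inverse> `` (S \<inter> Y)"
    using arcs by (auto simp: nbhd_def)
  moreover have "E `` (S \<inter> X) \<subseteq> Y" "E\<inverse> `` (S \<inter> Y) \<subseteq> X"
    using arcs by auto
  moreover from this have "finite (E `` (S \<inter> X))" "finite (E\<inverse> `` (S \<inter> Y))"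
    using fin finite_subset by blast+
  ultimately have "card (nbhd G S) = card (E `` (S \<inter> X)) + card (E\<inverse> `` (S \<inter> Y))"
    using XY(2) by (subst card_Un_disjoint[symmetric]) auto
  moreover have "card S = card (S \<inter> X) + card (S \<inter> Y)"
    using fin XY S by (subst card_Un_disjoint[symmetric]) (auto intro!: arg_cong[of _ _ card])
  ultimately have "r * card (E `` (S \<inter> X)) < card (S \<inter> X) \<or>
      r * card (E\<inverse> `` (S \<inter> Y)) < card (S \<inter> Y)"
    using S' by (auto simp: algebra_simps)
  then show ?thesis
  proof
    assume *: "r * card (E `` (S \<inter> X)) < card (S \<inter> X)"
    then have "S \<inter> X \<noteq> {}" by auto
    from extremal_trichotomy[OF r n G(1,2,4) XY(1,2) arcs _ this *] show ?thesis
      unfolding k_def m_def e(1) by simp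
  next
    assume *: "r * card (E\<inverse> `` (S \<inter> Y)) < card (S \<inter> Y)"
    then have "S \<inter> Y \<noteq> {}" by auto
    have YX: "pverts G = Y \<union> X" "Y \<inter> X = {}" using XY by auto
    from extremal_trichotomy[OF r n G(1,2,4) YX arcs' _ \<open>S \<inter> Y \<noteq> {}\<close> *] show ?thesis
      unfolding k_def m_def e(2) by simp
  qed
qed

section \<open>Comparison of f and g in the four cases\<close>

theorem theorem1p8:
  fixes r n :: nat and G :: "'a pair_pre_digraph"
  assumes "r \<ge> 1" and "n \<ge> r\<^sup>2 + r + 1"
    and "pair_graph G" and "card (pverts G) = n"
    and "bipartite G" and "no_isolated G"
    and "binding_number G < 1 / real r"
  shows
    "(r = 1 \<longrightarrow>
        num_edges G \<le> f_bound n 1 \<and>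
        (num_edges G = f_bound n 1 \<longleftrightarrow>
          is_complete_bipartite (n - nat \<lfloor>(real n - 1) / 2\<rfloor>) (nat \<lfloor>(real n - 1) / 2\<rfloor>) G))
     \<and> (r \<ge> 2 \<and> f_bound n r > g_bound n r \<longrightarrow>
        num_edges G \<le> f_bound n r \<and>
        (num_edges G = f_bound n r \<longleftrightarrow>
          is_complete_bipartite (n - nat \<lfloor>(real n - 1) / (real r + 1)\<rfloor>)
            (nat \<lfloor>(real n - 1) / (real r + 1)\<rfloor>) G))
     \<and> (r \<ge> 2 \<and> f_bound n r < g_bound n r \<longrightarrow>
        num_edges G \<le> g_bound n r \<and>
        (num_edges G = g_bound n r \<longleftrightarrow>
          graph_iso G (double_nested (nat \<lceil>(real n - real r - 1) / 2\<rceil>) (r + 1)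
            1 (nat \<lfloor>(real n - real r - 1) / 2\<rfloor> - 1)) \<or>
          graph_iso G (double_nested (nat \<lfloor>(real n - real r - 1) / 2\<rfloor>) (r + 1)
            1 (nat \<lceil>(real n - real r - 1) / 2\<rceil> - 1))))
     \<and> (r \<ge> 2 \<and> f_bound n r = g_bound n r \<longrightarrow>
        num_edges G \<le> f_bound n r \<and>
        (num_edges G = f_bound n r \<longleftrightarrow>
          is_complete_bipartite (n - nat \<lfloor>(real n - 1) / (real r + 1)\<rfloor>)
            (nat \<lfloor>(real n - 1) / (real r + 1)\<rfloor>) G \<or>
          graph_iso G (double_nested (nat \<lceil>(real n - real r - 1) / 2\<rceil>) (r + 1)
            1 (nat \<lfloor>(real n - real r - 1) / 2\<rfloor> - 1)) \<or>
          graph_iso G (double_nested (nat \<lfloor>(real n - real r - 1) / 2\<rfloor>) (r + 1)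
            1 (nat \<lceil>(real n - real r - 1) / 2\<rceil> - 1))))"
proof -
  define k m where "k = (n - 1) div (r + 1)" and "m = n - (r + 1)"
  have n: "n \<ge> 1" "n \<ge> r + 1" using assms(2) by auto
  have k: "nat \<lfloor>(real n - 1) / (real r + 1)\<rfloor> = k"
    using nat_floor_pred_divide[OF n(1)] by (simp add: k_def)
  have m: "nat \<lfloor>(real n - real r - 1) / 2\<rfloor> = m div 2" "nat \<lceil>(real n - real r - 1) / 2\<rceil> = (m + 1) div 2"
    using half_floor_ceiling[OF n(2)] by (simp_all add: m_def)
  have f: "f_bound n r = k * (n - k)"
    by (simp only: f_bound_def k)
  have g: "g_bound n r = (m div 2) * ((m + 1) div 2) + r + 1"
    by (simp only: g_bound_def m)
  define K where "K \<longleftrightarrow> is_complete_bipartite (n - k) k G"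
  define D where "D \<longleftrightarrow> graph_iso G (double_nested ((m + 1) div 2) (r + 1) 1 (m div 2 - 1)) \<or>
    graph_iso G (double_nested (m div 2) (r + 1) 1 ((m + 1) div 2 - 1))"
  have cases: "num_edges G < max (f_bound n r) (g_bound n r) \<or> num_edges G = f_bound n r \<and> K \<or>
      num_edges G = g_bound n r \<and> n \<ge> r + 4 \<and> D"
    using extremal_cases[OF assms] unfolding f g K_def D_def k_def m_def .
  have K: "num_edges G = f_bound n r" if K
    using num_edges_complete_bipartite[OF that[unfolded K_def]] by (simp add: f mult.commute)
  have D: "num_edges G = g_bound n r" if D "r \<ge> 2"
  proof -
    \<comment> \<open>For r >= 2 one has m >= r^2 >= 4, so the natural subtractions in the last
      parameter do not truncate and the part sizes add up as intended.\<close>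
    have "r * r \<ge> 2 * 2" using that by (intro mult_mono) auto
    then have "m \<ge> 4" using assms(2) by (simp add: m_def power2_eq_square)
    then have "m div 2 \<ge> 1" "(m + 1) div 2 \<ge> 1" by auto
    then have "1 + (m div 2 - 1) = m div 2" "1 + ((m + 1) div 2 - 1) = (m + 1) div 2" by auto
    moreover have "num_edges G = num_edges (double_nested ((m + 1) div 2) (r + 1) 1 (m div 2 - 1)) \<or>
        num_edges G = num_edges (double_nested (m div 2) (r + 1) 1 ((m + 1) div 2 - 1))"
      using that(1) num_edges_iso unfolding D_def by blast
    ultimately show ?thesis
      unfolding num_edges_double_nested g by (auto simp: mult.commute)
  qed
  \<comment> \<open>For r = 1, f and g agree at n = 3 and n = 4. The double nested alternative in
    \<open>cases\<close> requires n >= 5, where g < f, so only the complete bipartite graph can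
    attain f.\<close>
  have small: "g_bound n r \<le> f_bound n r \<and> (n \<ge> 5 \<longrightarrow> g_bound n r < f_bound n r)" if "r = 1"
  proof (cases "n \<ge> 5")
    case True
    have "k = (n - 1) div 2" "m = n - 2"
      using that by (simp_all add: k_def m_def numeral_2_eq_2)
    then show ?thesis
      using f_bound_greater_g_bound_1[OF True] that unfolding f g by simp
  next
    case False
    then have "n = 3 \<or> n = 4" using assms(2) that by auto
    then show ?thesis
      using that unfolding f g by (auto simp: k_def m_def simp flip: numeral_2_eq_2)
  qed
  have "r = 1 \<longrightarrow> num_edges G \<le> f_bound n r \<and> (num_edges G = f_bound n r \<longleftrightarrow> K)"
    using cases K small by auto
  moreover have "r \<ge> 2 \<and> f_bound n r > g_bound n r \<longrightarrow>
      num_edges G \<le> f_bound n r \<and> (num_edges G = f_bound n r \<longleftrightarrow> K)"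
    using cases K by auto
  moreover have "r \<ge> 2 \<and> f_bound n r < g_bound n r \<longrightarrow>
      num_edges G \<le> g_bound n r \<and> (num_edges G = g_bound n r \<longleftrightarrow> D)"
    using cases D by auto
  moreover have "r \<ge> 2 \<and> f_bound n r = g_bound n r \<longrightarrow>
      num_edges G \<le> f_bound n r \<and> (num_edges G = f_bound n r \<longleftrightarrow> K \<or> D)"
    using cases K D by auto
  moreover have "nat \<lfloor>(real n - 1) / 2\<rfloor> = k" if "r = 1"
    using k that by simp
  ultimately show ?thesis
    unfolding k m K_def D_def by (cases "r = 1") auto
qed

end
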